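(* The restricted Coxeter $\vee$-system $B_3(-1;1,1,3)$, that is, the set of seven covectors $$\{e_1\pm e_2,\quad \sqrt3\,(e_1\pm e_3),\quad \sqrt3\,(e_2\pm e_3),\quad 2\sqrt3\,e_3\}$$ on $\mathbb C^3$, is not harmonic.
   Context: **$\vee$-systems.** Let $V$ be a finite-dimensional complex vector space. A finite set $\mathcal A\subset V^*$ of pairwise non-collinear covectors spanning $V^*$, with canonical form $G_{\mathcal A}(x,y)=\sum_{\alpha\in\mathcal A}\alpha(x)\alpha(y)$ non-degenerate, is a $\vee$-system if, with $\alpha^\vee\in V$ defined by $G_{\mathcal A}(\alpha^\vee,x)=\alpha(x)$, for every $\alpha\in\mathcal A$ and every two-dimensional subspace $\Pi\subset V^*$ containing $\alpha$ one has $\sum_{\beta\in\Pi\cap\mathcal A}\beta(\alpha^\vee)\beta^\vee=\nu\alpha^\vee$ for some $\nu\in\mathbb C$. **Harmonic $\vee$-systems.** For $\kappa\in\mathbb C$ consider the system $$( * )_\kappa\qquad \partial_\xi\psi(x)=\kappa\sum_{\alpha\in\mathcal A}\frac{\alpha(\xi)\,\alpha(\psi(x))}{\alpha(x)}\,\alpha^\vee,\qquad \xi\in V,\ x\in V\setminus\bigcup_{\alpha\in\mathcal A}\{\alpha=0\},$$ for a vector field $\psi$. A $\vee$-system of rank $n=\dim V$ is harmonic if there are nonzero $\kappa_1,\dots,\kappa_n$ and polynomial vector fields $\psi^{(1)},\dots,\psi^{(n)}$, linearly independent at a generic point, such that $\psi^{(i)}$ solves $( * )_{\kappa_i}$ and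 $\kappa_1+\dots+\kappa_n=|\mathcal A|$, the number of covectors in $\mathcal A$. **The system.** $B_n(c_0;c_1,\dots,c_n)=\{\sqrt{c_ic_j}(e_i\pm e_j),\ 1\le i<j\le n;\ \sqrt{2c_i(c_i+c_0)}\,e_i,\ 1\le i\le n\}$ (zero covectors omitted), with $e_i$ the coordinate covectors on $\mathbb C^n$. The system $B_3(-1;1,1,3)$ is the restriction of the Coxeter system $D_5=\{e_i\pm e_j:1\le i<j\le5\}$ to the subspace $x_3=x_4=x_5$. *)

theory Defs
  imports "HOL-Analysis.Analysis" "HOL-Library.Function_Algebras"
begin

text \<open>
  The vector space is \<open>complex ^ 'n\<close>. Covectors are \<open>\<complex>\<close>-linear functions on it, regarded as
  elements of the complex vector space of all functions under the pointwise operations.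
\<close>

definition cscale :: "complex \<Rightarrow> ('v \<Rightarrow> complex) \<Rightarrow> ('v \<Rightarrow> complex)" where
  "cscale c f = (\<lambda>x. c * f x)"

interpretation covec: vector_space "cscale :: complex \<Rightarrow> ('v \<Rightarrow> complex) \<Rightarrow> ('v \<Rightarrow> complex)"
  by unfold_locales (simp_all add: cscale_def fun_eq_iff algebra_simps)

definition dual :: "(complex ^ 'n \<Rightarrow> complex) set" where
  "dual = {f. Vector_Spaces.linear (*s) (*) f}"

definition canon_form ::
    "(complex ^ 'n \<Rightarrow> complex) set \<Rightarrow> complex ^ 'n \<Rightarrow> complex ^ 'n \<Rightarrow> complex" where
  "canon_form A x y = (\<Sum>\<alpha>\<in>A. \<alpha> x * \<alpha> y)"

definition nondegenerate :: "(complex ^ 'n \<Rightarrow> complex ^ 'n \<Rightarrow> complex) \<Rightarrow> bool" where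
  "nondegenerate G \<longleftrightarrow> (\<forall>x. (\<forall>y. G x y = 0) \<longrightarrow> x = 0)"

text \<open>Well defined for covectors \<open>\<alpha>\<close> whenever the canonical form of \<open>A\<close> is nondegenerate.\<close>

definition vee :: "(complex ^ 'n \<Rightarrow> complex) set \<Rightarrow> (complex ^ 'n \<Rightarrow> complex) \<Rightarrow> complex ^ 'n" where
  "vee A \<alpha> = (THE v. \<forall>x. canon_form A v x = \<alpha> x)"

definition vee_system :: "(complex ^ 'n \<Rightarrow> complex) set \<Rightarrow> bool" where
  "vee_system A \<longleftrightarrow>
     finite A \<and> A \<subseteq> dual \<and>
     (\<forall>\<alpha>\<in>A. \<forall>\<beta>\<in>A. \<alpha> \<noteq> \<beta> \<longrightarrow> covec.independent {\<alpha>, \<beta>}) \<and>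
     covec.span A = dual \<and>
     nondegenerate (canon_form A) \<and>
     (\<forall>\<alpha>\<in>A. \<forall>P. covec.subspace P \<and> P \<subseteq> dual \<and> covec.dim P = 2 \<and> \<alpha> \<in> P \<longrightarrow>
        (\<exists>\<nu>. (\<Sum>\<beta>\<in>P \<inter> A. \<beta> (vee A \<alpha>) *s vee A \<beta>) = \<nu> *s vee A \<alpha>))"

text \<open>
  The directional derivative \<open>\<partial>\<^sub>\<xi>\<psi>(x)\<close> is the complex derivative of \<open>t \<mapsto> \<psi>(x + t\<xi>)\<close> at \<open>t = 0\<close>,
  taken componentwise.
\<close>

definition solves_system ::
    "complex \<Rightarrow> (complex ^ 'n \<Rightarrow> complex) set \<Rightarrow> (complex ^ 'n \<Rightarrow> complex ^ 'n) \<Rightarrow> bool" where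
  "solves_system \<kappa> A \<psi> \<longleftrightarrow>
     (\<forall>\<xi> x. (\<forall>\<alpha>\<in>A. \<alpha> x \<noteq> 0) \<longrightarrow>
        (\<forall>i. ((\<lambda>t::complex. \<psi> (x + t *s \<xi>) $ i) has_field_derivative
                (\<kappa> *s (\<Sum>\<alpha>\<in>A. (\<alpha> \<xi> * \<alpha> (\<psi> x) / \<alpha> x) *s vee A \<alpha>)) $ i) (at 0)))"

definition poly_fun :: "(complex ^ 'n \<Rightarrow> complex) \<Rightarrow> bool" where
  "poly_fun p \<longleftrightarrow>
     (\<exists>(M :: ('n \<Rightarrow> nat) set) c. finite M \<and> (\<forall>x. p x = (\<Sum>m\<in>M. c m * (\<Prod>i\<in>UNIV. x $ i ^ m i))))"

definition poly_vector_field :: "(complex ^ 'n \<Rightarrow> complex ^ 'n) \<Rightarrow> bool" where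
  "poly_vector_field \<psi> \<longleftrightarrow> (\<forall>i. poly_fun (\<lambda>x. \<psi> x $ i))"

text \<open>A generic point is one outside the zero set of some nonzero polynomial.\<close>

definition generically :: "(complex ^ 'n \<Rightarrow> bool) \<Rightarrow> bool" where
  "generically Q \<longleftrightarrow> (\<exists>p. poly_fun p \<and> (\<exists>x. p x \<noteq> 0) \<and> (\<forall>x. p x \<noteq> 0 \<longrightarrow> Q x))"

text \<open>The \<open>n = CARD('n)\<close> fields and exponents are indexed by the coordinate type \<open>'n\<close>.\<close>

definition harmonic :: "(complex ^ 'n \<Rightarrow> complex) set \<Rightarrow> bool" where
  "harmonic A \<longleftrightarrow>
     vee_system A \<and>
     (\<exists>(\<kappa> :: 'n \<Rightarrow> complex) (\<psi> :: 'n \<Rightarrow> complex ^ 'n \<Rightarrow> complex ^ 'n).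
        (\<forall>i. \<kappa> i \<noteq> 0) \<and>
        (\<forall>i. poly_vector_field (\<psi> i)) \<and>
        generically (\<lambda>x. inj (\<lambda>i. \<psi> i x) \<and> vec.independent (range (\<lambda>i. \<psi> i x))) \<and>
        (\<forall>i. solves_system (\<kappa> i) A (\<psi> i)) \<and>
        (\<Sum>i\<in>UNIV. \<kappa> i) = of_nat (card A))"

text \<open>
  The family \<open>B\<^sub>n(c\<^sub>0; c\<^sub>1, \<dots>, c\<^sub>n)\<close> built on covectors \<open>e 1, \<dots>, e n\<close>; the square roots are
  principal ones.
\<close>

definition B_system ::
    "(nat \<Rightarrow> 'v \<Rightarrow> complex) \<Rightarrow> nat \<Rightarrow> complex \<Rightarrow> (nat \<Rightarrow> complex) \<Rightarrow> ('v \<Rightarrow> complex) set" where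
  "B_system e n c0 c =
     ({cscale (csqrt (c i * c j)) (e i + e j) | i j. 1 \<le> i \<and> i < j \<and> j \<le> n} \<union>
      {cscale (csqrt (c i * c j)) (e i - e j) | i j. 1 \<le> i \<and> i < j \<and> j \<le> n} \<union>
      {cscale (csqrt (2 * c i * (c i + c0))) (e i) | i. 1 \<le> i \<and> i \<le> n}) - {0}"

text \<open>In the index type \<open>3\<close> one has \<open>3 = 0\<close>, so \<open>coord 1, coord 2, coord 3\<close> are all the coordinates.\<close>

definition coord :: "nat \<Rightarrow> complex ^ 3 \<Rightarrow> complex" where
  "coord k = (\<lambda>x. x $ of_nat k)"

end

theory Submission imports Defs "HOL-Computational_Algebra.Polynomial"
begin

text \<open>
  Along the line from a point \<open>p\<close> to a regular point, the lowest-order coefficient of a polynomial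
  solution is an eigenvector of the residue of the system at \<open>p\<close>, with eigenvalue its order. At
  \<open>p = 0\<close> the residue is \<open>\<kappa>\<close> times the identity, so \<open>\<kappa>\<close> is the degree of the solution. At
  \<open>p = (1,0,0)\<close>, where \<open>e\<^sub>2 \<plusminus> e\<^sub>3\<close> and \<open>e\<^sub>3\<close> vanish, the residue has eigenvalues \<open>0\<close> and \<open>3\<kappa>/4\<close>. If
  \<open>\<kappa> \<in> {1, 2, 3}\<close>, then \<open>3\<kappa>/4\<close> is not an integer, so \<open>\<psi>(p)\<close> is a multiple of \<open>p\<close> and determines
  \<open>\<psi>\<close>; hence at most one solution up to scaling exists for each such \<open>\<kappa>\<close>. By the same argument at
  \<open>(1,0,0)\<close> and \<open>(0,1,0)\<close> this solution commutes with the sign flips \<open>(1,-1,-1)\<close> and \<open>(-1,1,1)\<close>,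
  so it is odd, which excludes \<open>\<kappa> = 2\<close>. But three positive integers different from \<open>2\<close> with sum
  \<open>7\<close> are \<open>1,1,5\<close> or \<open>1,3,3\<close>, and both repeat an exponent that can occur only once.
\<close>

section \<open>Polynomial solutions near a flat\<close>

lemma dual_add: "\<alpha> (x + y) = \<alpha> x + \<alpha> y"
  and dual_scale: "\<alpha> (c *s x) = c * \<alpha> x" if "\<alpha> \<in> dual"
proof -
  interpret Vector_Spaces.linear "(*s)" "(*)" \<alpha> using that by (simp add: dual_def)
  show "\<alpha> (x + y) = \<alpha> x + \<alpha> y" "\<alpha> (c *s x) = c * \<alpha> x" by (rule add scale)+
qed

lemma dual_expansion:
  fixes \<alpha> :: "complex ^ 'n \<Rightarrow> complex"
  assumes "\<alpha> \<in> dual"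
  shows "\<alpha> x = (\<Sum>i\<in>UNIV. x $ i * \<alpha> (axis i 1))"
proof -
  interpret Vector_Spaces.linear "(*s)" "(*)" \<alpha> using assms by (simp add: dual_def)
  have "\<alpha> x = \<alpha> (\<Sum>i\<in>UNIV. x $ i *s axis i 1)" by (simp add: basis_expansion)
  also have "\<dots> = (\<Sum>i\<in>UNIV. x $ i * \<alpha> (axis i 1))" by (simp add: sum scale)
  finally show ?thesis .
qed

lemma dual_tendsto:
  fixes \<alpha> :: "complex ^ 'n \<Rightarrow> complex"
  assumes "\<alpha> \<in> dual" "(f \<longlongrightarrow> v) F"
  shows "((\<lambda>t. \<alpha> (f t)) \<longlongrightarrow> \<alpha> v) F"
proof -
  have "((\<lambda>t. \<Sum>i\<in>UNIV. f t $ i * \<alpha> (axis i 1)) \<longlongrightarrow> (\<Sum>i\<in>UNIV. v $ i * \<alpha> (axis i 1))) F"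
    by (intro tendsto_intros assms(2))
  then show ?thesis by (simp only: dual_expansion[OF assms(1), symmetric])
qed

definition regular :: "(complex ^ 'n \<Rightarrow> complex) set \<Rightarrow> complex ^ 'n \<Rightarrow> bool" where
  "regular A x \<longleftrightarrow> (\<forall>\<alpha>\<in>A. \<alpha> x \<noteq> 0)"

text \<open>On lines, polynomial fields become univariate polynomials, for which orders of vanishing
  and finiteness of roots are available.\<close>

lemma poly_fun_on_line:
  assumes "poly_fun f"
  obtains q where "\<And>t. f (u + t *s v) = poly q t"
proof -
  obtain M c where "finite M" and f: "\<And>x. f x = (\<Sum>m\<in>M. c m * (\<Prod>i\<in>UNIV. x $ i ^ m i))"
    using assms unfolding poly_fun_def by blast
  have "f (u + t *s v) = poly (\<Sum>m\<in>M. smult (c m) (\<Prod>i\<in>UNIV. [:u $ i, v $ i:] ^ m i)) t" for t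
    by (simp add: f poly_sum poly_prod)
  then show ?thesis using that by blast
qed

text \<open>
  Restricted to a line through \<open>p\<close> that leaves all the hyperplanes containing \<open>p\<close>, the system has
  a regular singular point at \<open>p\<close>, and this is its residue.
\<close>

definition flat_residue ::
    "complex \<Rightarrow> (complex ^ 'n \<Rightarrow> complex) set \<Rightarrow> complex ^ 'n \<Rightarrow> complex ^ 'n \<Rightarrow> complex ^ 'n" where
  "flat_residue \<kappa> A p v = \<kappa> *s (\<Sum>\<alpha> | \<alpha> \<in> A \<and> \<alpha> p = 0. \<alpha> v *s vee A \<alpha>)"

text \<open>Along the line each covector of \<open>A\<close> is an affine function of
  \<open>t\<close> that is nonzero at \<open>t = 1\<close>. If \<open>\<alpha> p \<noteq> 0\<close>,
  it stays nonzero near \<open>0\<close> by continuity; otherwise it equals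
  \<open>t * \<alpha> y\<close> with \<open>\<alpha> y \<noteq> 0\<close>. Finiteness of
  \<open>A\<close> combines these neighbourhoods.\<close>

lemma eventually_regular_on_line:
  assumes "finite A" "A \<subseteq> dual" "regular A (p + y)"
  shows "\<forall>\<^sub>F t in at 0. regular A (p + t *s y)"
proof -
  have "\<forall>\<^sub>F t in at 0. \<alpha> (p + t *s y) \<noteq> 0" if "\<alpha> \<in> A" for \<alpha>
  proof -
    have \<alpha>: "\<alpha> \<in> dual" "\<alpha> p + \<alpha> y \<noteq> 0"
      using assms that dual_add[of \<alpha> p y] by (auto simp: regular_def)
    show ?thesis
    proof (cases "\<alpha> p = 0")
      case True
      then show ?thesis using \<alpha>
        by (auto simp: eventually_at_filter dual_add dual_scale)
    next
      case False
      have "((\<lambda>t. \<alpha> p + t * \<alpha> y) \<longlongrightarrow> \<alpha> p + 0 * \<alpha> y) (at 0)" by (intro tendsto_intros)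
      then have "((\<lambda>t. \<alpha> (p + t *s y)) \<longlongrightarrow> \<alpha> p) (at 0)" using \<alpha> by (simp add: dual_add dual_scale)
      then show ?thesis using False by (rule tendsto_imp_eventually_ne)
    qed
  qed
  then show ?thesis unfolding regular_def using assms(1) by (simp add: eventually_ball_finite)
qed

lemma solution_derivative_on_line:
  fixes \<psi> :: "complex ^ 'n \<Rightarrow> complex ^ 'n"
  assumes "solves_system \<kappa> A \<psi>" "regular A (p + t *s y)"
    and q: "\<And>t. \<psi> (p + t *s y) $ i = poly q t"
  shows "poly (pderiv q) t =
    (\<kappa> *s (\<Sum>\<alpha>\<in>A. (\<alpha> y * \<alpha> (\<psi> (p + t *s y)) / \<alpha> (p + t *s y)) *s vee A \<alpha>)) $ i"
proof -
  have "((\<lambda>r. \<psi> (p + t *s y + r *s y) $ i) has_field_derivative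
      (\<kappa> *s (\<Sum>\<alpha>\<in>A. (\<alpha> y * \<alpha> (\<psi> (p + t *s y)) / \<alpha> (p + t *s y)) *s vee A \<alpha>)) $ i) (at 0)"
    using assms(1,2) unfolding solves_system_def regular_def by blast
  moreover have "(\<lambda>r. \<psi> (p + t *s y + r *s y) $ i) = (\<lambda>r. poly q (t + r))"
    using q[of "t + _"] by (simp add: vec.scale_left_distrib add.assoc)
  moreover have "((\<lambda>r. poly q (t + r)) has_field_derivative poly (pderiv q) t) (at 0)"
    unfolding add.commute[of t] by (subst DERIV_shift[symmetric]) simp
  ultimately show ?thesis using DERIV_unique by simp
qed

text \<open>Insert \<open>t ^ k *s H t\<close> into the equation, multiply by \<open>t\<close>,
  divide by \<open>t ^ k\<close> and let \<open>t\<close> tend to \<open>0\<close>. The left side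
  becomes \<open>k H + t H'\<close> and tends to \<open>k H(0)\<close>; on the right only the
  covectors vanishing at \<open>p\<close> survive.\<close>

lemma leading_term_residue:
  fixes \<psi> :: "complex ^ 'n \<Rightarrow> complex ^ 'n" and h :: "'n \<Rightarrow> complex poly"
  assumes A: "finite A" "A \<subseteq> dual" and sol: "solves_system \<kappa> A \<psi>" and reg: "regular A (p + y)"
    and h: "\<And>t i. \<psi> (p + t *s y) $ i = t ^ k * poly (h i) t"
  shows "of_nat k *s (\<chi> i. poly (h i) 0) = flat_residue \<kappa> A p (\<chi> i. poly (h i) 0)"
proof -
  define H where "H t = (\<chi> i. poly (h i) t)" for t
  have H_lim: "(H \<longlongrightarrow> H 0) (at 0)"
    unfolding H_def by (intro tendsto_vec_lambda poly_isCont[unfolded isCont_def])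
  have \<psi>: "\<psi> (p + t *s y) = t ^ k *s H t" for t
    by (simp add: vec_eq_iff H_def h)
  define R where "R \<alpha> t = t * \<alpha> y * \<alpha> (H t) / \<alpha> (p + t *s y)" for \<alpha> t
  have R_lim: "(R \<alpha> \<longlongrightarrow> (if \<alpha> p = 0 then \<alpha> (H 0) else 0)) (at 0)" if "\<alpha> \<in> A" for \<alpha>
  proof -
    have \<alpha>: "\<alpha> \<in> dual" "\<alpha> p + \<alpha> y \<noteq> 0"
      using A reg that dual_add[of \<alpha> p y] by (auto simp: regular_def)
    have lim: "((\<lambda>t. \<alpha> (H t)) \<longlongrightarrow> \<alpha> (H 0)) (at 0)" using \<alpha>(1) H_lim by (rule dual_tendsto)
    show ?thesis
    \<comment> \<open>If \<open>\<alpha>\<close> vanishes at \<open>p\<close>, its denominator is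
      \<open>t * \<alpha> y\<close> and cancels exactly; otherwise the denominator has a nonzero
      limit and the factor \<open>t\<close> kills the term.\<close>
    proof (cases "\<alpha> p = 0")
      case True
      have "\<forall>\<^sub>F t in at 0. \<alpha> (H t) = R \<alpha> t"
        using \<alpha> True by (auto simp: eventually_at_filter R_def dual_add dual_scale)
      then show ?thesis using lim True by (simp add: tendsto_cong)
    next
      case False
      have "((\<lambda>t. t * \<alpha> y * \<alpha> (H t) / (\<alpha> p + t * \<alpha> y)) \<longlongrightarrow>
          0 * \<alpha> y * \<alpha> (H 0) / (\<alpha> p + 0 * \<alpha> y)) (at 0)"
        using False by (intro tendsto_intros lim) auto
      then show ?thesis using False \<alpha>
        by (simp add: R_def[abs_def] dual_add dual_scale)
    qed
  qed
  have "of_nat k * H 0 $ i = flat_residue \<kappa> A p (H 0) $ i" for i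
  proof (rule tendsto_unique)
    show "((\<lambda>t. of_nat k * poly (h i) t + t * poly (pderiv (h i)) t) \<longlongrightarrow> of_nat k * H 0 $ i) (at 0)"
    proof -
      have "((\<lambda>t. of_nat k * poly (h i) t + t * poly (pderiv (h i)) t) \<longlongrightarrow>
          of_nat k * poly (h i) 0 + 0 * poly (pderiv (h i)) 0) (at 0)"
        by (intro tendsto_intros poly_isCont[unfolded isCont_def])
      then show ?thesis by (simp add: H_def)
    qed
    have "((\<lambda>t. \<kappa> * (\<Sum>\<alpha>\<in>A. R \<alpha> t * vee A \<alpha> $ i)) \<longlongrightarrow>
        \<kappa> * (\<Sum>\<alpha>\<in>A. (if \<alpha> p = 0 then \<alpha> (H 0) else 0) * vee A \<alpha> $ i)) (at 0)"
      by (intro tendsto_intros R_lim)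
    moreover have "(\<Sum>\<alpha>\<in>A. (if \<alpha> p = 0 then \<alpha> (H 0) else 0) * vee A \<alpha> $ i)
        = (\<Sum>\<alpha> | \<alpha> \<in> A \<and> \<alpha> p = 0. \<alpha> (H 0) * vee A \<alpha> $ i)"
      using A(1) by (intro sum.mono_neutral_cong_right) auto
    ultimately have lim: "((\<lambda>t. \<kappa> * (\<Sum>\<alpha>\<in>A. R \<alpha> t * vee A \<alpha> $ i)) \<longlongrightarrow> flat_residue \<kappa> A p (H 0) $ i) (at 0)"
      by (simp add: flat_residue_def)
    have "\<forall>\<^sub>F t in at 0. \<kappa> * (\<Sum>\<alpha>\<in>A. R \<alpha> t * vee A \<alpha> $ i)
        = of_nat k * poly (h i) t + t * poly (pderiv (h i)) t"
      using eventually_regular_on_line[OF A reg] eventually_neq_at_within[of 0 0 UNIV]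
    proof eventually_elim
      case (elim t)
      have "poly (pderiv (monom 1 k * h i)) t = (\<kappa> *s (\<Sum>\<alpha>\<in>A. (\<alpha> y * \<alpha> (\<psi> (p + t *s y)) / \<alpha> (p + t *s y)) *s vee A \<alpha>)) $ i"
        using sol elim(1) by (rule solution_derivative_on_line) (simp add: h poly_monom)
      also have "\<dots> = \<kappa> * (\<Sum>\<alpha>\<in>A. (\<alpha> y * \<alpha> (\<psi> (p + t *s y)) / \<alpha> (p + t *s y)) * vee A \<alpha> $ i)"
        by simp
      also have "(\<Sum>\<alpha>\<in>A. (\<alpha> y * \<alpha> (\<psi> (p + t *s y)) / \<alpha> (p + t *s y)) * vee A \<alpha> $ i)
          = (\<Sum>\<alpha>\<in>A. t ^ k / t * (R \<alpha> t * vee A \<alpha> $ i))"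
        using A elim(2) by (intro sum.cong) (auto simp: \<psi> R_def dual_scale subset_iff)
      finally have "t * poly (pderiv (monom 1 k * h i)) t = t ^ k * (\<kappa> * (\<Sum>\<alpha>\<in>A. R \<alpha> t * vee A \<alpha> $ i))"
        using elim(2) by (simp only: sum_distrib_left[symmetric]) simp
      \<comment> \<open>The case \<open>k = 0\<close> is separate because the derivative of the
        monomial carries the truncated exponent \<open>k - 1\<close>.\<close>
      moreover have "t * poly (pderiv (monom 1 k * h i)) t
          = t ^ k * (of_nat k * poly (h i) t + t * poly (pderiv (h i)) t)"
        by (cases k) (simp_all add: pderiv_mult pderiv_monom poly_monom algebra_simps)
      ultimately show ?case using elim(2) by simp
    qed
    with lim show "((\<lambda>t. of_nat k * poly (h i) t + t * poly (pderiv (h i)) t) \<longlongrightarrow> flat_residue \<kappa> A p (H 0) $ i) (at 0)"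
      by (rule Lim_transform_eventually)
  qed simp
  then show ?thesis by (simp add: vec_eq_iff H_def)
qed

text \<open>Since \<open>\<psi>\<close> is nonzero at \<open>t = 1\<close>, some component is a
  nonzero polynomial in \<open>t\<close>. Take \<open>k\<close> to be the least order among all
  components and factor out \<open>t ^ k\<close>; the values \<open>poly (h i) 0\<close> are then
  the coefficients of \<open>t ^ k\<close>, not all zero by the choice of \<open>k\<close>.\<close>

lemma solution_leading_term:
  fixes \<psi> :: "complex ^ 'n \<Rightarrow> complex ^ 'n"
  assumes "finite A" "A \<subseteq> dual" "poly_vector_field \<psi>" "solves_system \<kappa> A \<psi>"
    and "regular A x" "\<psi> x \<noteq> 0"
  obtains k h where "\<And>t i. \<psi> (p + t *s (x - p)) $ i = t ^ k * poly (h i) t"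
    and "(\<chi> i. poly (h i) 0) \<noteq> 0"
    and "of_nat k *s (\<chi> i. poly (h i) 0) = flat_residue \<kappa> A p (\<chi> i. poly (h i) 0)"
proof -
  define y where "y = x - p"
  have "\<exists>q. \<forall>t. \<psi> (p + t *s y) $ i = poly q t" for i
    using assms(3) poly_fun_on_line[of "\<lambda>x. \<psi> x $ i" p y] unfolding poly_vector_field_def by metis
  then obtain q where q: "\<And>i t. \<psi> (p + t *s y) $ i = poly (q i) t" by metis
  have "\<exists>i. poly (q i) 1 \<noteq> 0"
    using q[of 1] assms(6) by (auto simp: y_def vec_eq_iff)
  then have ex: "\<exists>n i. coeff (q i) n \<noteq> 0"
    by (metis poly_0 poly_eqI coeff_0)
  define k where "k = (LEAST n. \<exists>i. coeff (q i) n \<noteq> 0)"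
  have k: "\<exists>i. coeff (q i) k \<noteq> 0" unfolding k_def using LeastI_ex[OF ex] .
  have "\<forall>j<k. coeff (q i) j = 0" for i unfolding k_def using not_less_Least by blast
  then have "\<exists>h. q i = monom 1 k * h" for i
    by (metis monom_1_dvd_iff' dvdE)
  then obtain h where h: "\<And>i. q i = monom 1 k * h i" by metis
  have 1: "\<psi> (p + t *s y) $ i = t ^ k * poly (h i) t" for t i
    by (simp add: q h poly_monom)
  have 2: "(\<chi> i. poly (h i) 0) \<noteq> 0"
    using k by (auto simp: vec_eq_iff h coeff_monom_mult poly_0_coeff_0)
  have "regular A (p + y)" using assms(5) by (simp add: y_def)
  from leading_term_residue[OF assms(1,2,4) this 1] 1 2 show ?thesis
    using that unfolding y_def by blast
qed

text \<open>This is \<open>leading_term_residue\<close> with \<open>k = 0\<close>, where no power of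
  \<open>t\<close> is split off; the regular point \<open>x\<close> supplies the direction of the
  line.\<close>

lemma solution_tangent_to_flat:
  fixes \<psi> :: "complex ^ 'n \<Rightarrow> complex ^ 'n"
  assumes "finite A" "A \<subseteq> dual" "poly_vector_field \<psi>" "solves_system \<kappa> A \<psi>" "regular A x"
  shows "flat_residue \<kappa> A p (\<psi> p) = 0"
proof -
  have "\<exists>q. \<forall>t. \<psi> (p + t *s (x - p)) $ i = poly q t" for i
    using assms(3) poly_fun_on_line[of "\<lambda>x. \<psi> x $ i" p "x - p"] unfolding poly_vector_field_def by metis
  then obtain q where q: "\<And>i t. \<psi> (p + t *s (x - p)) $ i = poly (q i) t" by metis
  have "(\<chi> i. poly (q i) 0) = \<psi> p" using q[of 0] by (simp add: vec_eq_iff)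
  then show ?thesis
    using leading_term_residue[OF assms(1,2,4), of p "x - p" 0 q] q assms(5) by simp
qed

text \<open>Uniqueness principle: applied to a difference of solutions, it says that the value at
  \<open>p\<close> determines a solution at regular points. If \<open>\<psi> x\<close> were nonzero,
  \<open>\<psi> p = 0\<close> would make the order of the leading term positive, and
  \<open>eig\<close> excludes such an eigenvalue.\<close>

lemma solution_eq_0:
  fixes \<psi> :: "complex ^ 'n \<Rightarrow> complex ^ 'n"
  assumes "finite A" "A \<subseteq> dual" "poly_vector_field \<psi>" "solves_system \<kappa> A \<psi>" "regular A x"
    and "\<psi> p = 0"
    and eig: "\<And>k v. k > 0 \<Longrightarrow> of_nat k *s v = flat_residue \<kappa> A p v \<Longrightarrow> v = 0"
  shows "\<psi> x = 0"
proof (rule ccontr)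
  assume "\<psi> x \<noteq> 0"
  then obtain k h where h: "\<And>t i. \<psi> (p + t *s (x - p)) $ i = t ^ k * poly (h i) t"
    and ne: "(\<chi> i. poly (h i) 0) \<noteq> 0"
    and res: "of_nat k *s (\<chi> i. poly (h i) 0) = flat_residue \<kappa> A p (\<chi> i. poly (h i) 0)"
    using solution_leading_term[OF assms(1-5)] by metis
  have "k > 0"
  proof (rule ccontr)
    assume "\<not> k > 0"
    then show False using h[of 0] ne assms(6) by (auto simp: vec_eq_iff)
  qed
  from eig[OF this res] ne show False by simp
qed

section \<open>Closure properties of polynomial solutions; generic regular points\<close>

lemma poly_fun_add:
  assumes "poly_fun f" "poly_fun g"
  shows "poly_fun (\<lambda>x. f x + g x)"
proof -
  obtain M c N d where "finite M" "finite N"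
    and f: "\<And>x. f x = (\<Sum>m\<in>M. c m * (\<Prod>i\<in>UNIV. x $ i ^ m i))"
    and g: "\<And>x. g x = (\<Sum>m\<in>N. d m * (\<Prod>i\<in>UNIV. x $ i ^ m i))"
    using assms unfolding poly_fun_def by blast
  have "f x + g x = (\<Sum>m\<in>M \<union> N. ((if m \<in> M then c m else 0) + (if m \<in> N then d m else 0)) *
      (\<Prod>i\<in>UNIV. x $ i ^ m i))" for x
  proof -
    have "f x = (\<Sum>m\<in>M \<union> N. (if m \<in> M then c m else 0) * (\<Prod>i\<in>UNIV. x $ i ^ m i))"
      "g x = (\<Sum>m\<in>M \<union> N. (if m \<in> N then d m else 0) * (\<Prod>i\<in>UNIV. x $ i ^ m i))"
      unfolding f g using \<open>finite M\<close> \<open>finite N\<close> by (auto intro!: sum.mono_neutral_cong_left)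
    then show ?thesis by (simp add: distrib_right sum.distrib)
  qed
  then show ?thesis unfolding poly_fun_def
    using \<open>finite M\<close> \<open>finite N\<close>
    by (intro exI[of _ "M \<union> N"] exI[of _ "\<lambda>m. (if m \<in> M then c m else 0) + (if m \<in> N then d m else 0)"]) simp
qed

lemma poly_fun_cmult:
  assumes "poly_fun f"
  shows "poly_fun (\<lambda>x. a * f x)"
proof -
  obtain M c where "finite M" "\<And>x. f x = (\<Sum>m\<in>M. c m * (\<Prod>i\<in>UNIV. x $ i ^ m i))"
    using assms unfolding poly_fun_def by blast
  then show ?thesis unfolding poly_fun_def
    by (intro exI[of _ M] exI[of _ "\<lambda>m. a * c m"]) (simp add: sum_distrib_left mult.assoc)
qed

text \<open>Sign changes are diagonal, and a diagonal map sends each monomial to a multiple of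
  itself, so polynomiality is preserved by rescaling coefficients.\<close>

definition diag_act :: "complex ^ 'n \<Rightarrow> complex ^ 'n \<Rightarrow> complex ^ 'n" where
  "diag_act d x = (\<chi> i. d $ i * x $ i)"

lemma diag_act_nth [simp]: "diag_act d x $ i = d $ i * x $ i"
  by (simp add: diag_act_def)

lemma poly_fun_diag_act:
  assumes "poly_fun f"
  shows "poly_fun (\<lambda>x. f (diag_act d x))"
proof -
  obtain M c where "finite M" "\<And>x. f x = (\<Sum>m\<in>M. c m * (\<Prod>i\<in>UNIV. x $ i ^ m i))"
    using assms unfolding poly_fun_def by blast
  then show ?thesis unfolding poly_fun_def
    by (intro exI[of _ M] exI[of _ "\<lambda>m. c m * (\<Prod>i\<in>UNIV. d $ i ^ m i)"])
      (simp add: power_mult_distrib prod.distrib mult.assoc)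
qed

lemma poly_vector_field_lincomb:
  assumes "poly_vector_field \<psi>" "poly_vector_field \<phi>"
  shows "poly_vector_field (\<lambda>x. a *s \<psi> x + b *s \<phi> x)"
  using assms unfolding poly_vector_field_def
  by (auto intro!: poly_fun_add poly_fun_cmult)

lemma poly_vector_field_conj_diag_act:
  assumes "poly_vector_field \<psi>"
  shows "poly_vector_field (\<lambda>x. diag_act d (\<psi> (diag_act d x)))"
  using assms unfolding poly_vector_field_def diag_act_nth
  by (intro allI poly_fun_cmult poly_fun_diag_act[of "\<lambda>x. \<psi> x $ i" for i]) blast

lemma solves_system_lincomb:
  assumes "A \<subseteq> dual" "solves_system \<kappa> A \<psi>" "solves_system \<kappa> A \<phi>"
  shows "solves_system \<kappa> A (\<lambda>x. a *s \<psi> x + b *s \<phi> x)"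
  unfolding solves_system_def
proof (intro allI impI)
  fix \<xi> x i assume reg: "\<forall>\<alpha>\<in>A. \<alpha> x \<noteq> 0"
  let ?F = "\<lambda>v. (\<kappa> *s (\<Sum>\<alpha>\<in>A. (\<alpha> \<xi> * \<alpha> v / \<alpha> x) *s vee A \<alpha>)) $ i"
  have "((\<lambda>t. a * \<psi> (x + t *s \<xi>) $ i + b * \<phi> (x + t *s \<xi>) $ i) has_field_derivative
      a * ?F (\<psi> x) + b * ?F (\<phi> x)) (at 0)"
    using assms(2,3) reg unfolding solves_system_def
    by (intro DERIV_add DERIV_cmult) blast+
  moreover have "a * ?F (\<psi> x) + b * ?F (\<phi> x) = ?F (a *s \<psi> x + b *s \<phi> x)"
  proof -
    have "?F (a *s \<psi> x + b *s \<phi> x) = \<kappa> * (\<Sum>\<alpha>\<in>A. a * ((\<alpha> \<xi> * \<alpha> (\<psi> x) / \<alpha> x) * vee A \<alpha> $ i)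
        + b * ((\<alpha> \<xi> * \<alpha> (\<phi> x) / \<alpha> x) * vee A \<alpha> $ i))"
      using assms(1)
      by (simp add: dual_add dual_scale subset_iff algebra_simps add_divide_distrib cong: sum.cong)
    then show ?thesis
      by (simp only: sum.distrib sum_distrib_left[symmetric]) (simp add: algebra_simps)
  qed
  ultimately show "((\<lambda>t. (a *s \<psi> (x + t *s \<xi>) + b *s \<phi> (x + t *s \<xi>)) $ i) has_field_derivative
      ?F (a *s \<psi> x + b *s \<phi> x)) (at 0)" by simp
qed

text \<open>On the line through \<open>u\<close> in the direction \<open>z\<close>, the polynomial
  \<open>P\<close> is nonzero at \<open>t = 0\<close>, so it has finitely many roots, and each
  covector vanishes for only one \<open>t\<close>. Infinitely many parameters remain.\<close>

lemma generic_regular_point: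
  assumes "generically Q" "finite A" "A \<subseteq> dual" "regular A z"
  obtains x where "Q x" "regular A x"
proof -
  obtain P u where P: "poly_fun P" "P u \<noteq> 0" "\<And>x. P x \<noteq> 0 \<Longrightarrow> Q x"
    using assms(1) unfolding generically_def by blast
  obtain q where q: "\<And>t. P (u + t *s z) = poly q t" using poly_fun_on_line[OF P(1)] by blast
  have "poly q 0 \<noteq> 0" using q[of 0] P(2) by simp
  then have "finite {t. poly q t = 0}" by (intro poly_roots_finite) auto
  moreover have "finite (\<Union>\<alpha>\<in>A. {- \<alpha> u / \<alpha> z})" using assms(2) by blast
  ultimately have "finite ({t. poly q t = 0} \<union> (\<Union>\<alpha>\<in>A. {- \<alpha> u / \<alpha> z}))" by blast
  then obtain t where t: "poly q t \<noteq> 0" "\<And>\<alpha>. \<alpha> \<in> A \<Longrightarrow> t \<noteq> - \<alpha> u / \<alpha> z"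
    using ex_new_if_finite[OF infinite_UNIV_char_0] by blast
  have "regular A (u + t *s z)" unfolding regular_def
  proof
    fix \<alpha> assume \<alpha>: "\<alpha> \<in> A"
    then have "\<alpha> \<in> dual" "\<alpha> z \<noteq> 0" "t \<noteq> - \<alpha> u / \<alpha> z"
      using assms t by (auto simp: regular_def)
    then show "\<alpha> (u + t *s z) \<noteq> 0"
      by (auto simp: dual_add dual_scale field_simps add_eq_0_iff)
  qed
  moreover have "Q (u + t *s z)" using P(3) q t(1) by simp
  ultimately show ?thesis using that by blast
qed

section \<open>The system \<open>B\<^sub>3(-1; 1, 1, 3)\<close>\<close>

definition cov :: "complex ^ 3 \<Rightarrow> complex ^ 3 \<Rightarrow> complex" where
  "cov a x = a $ 1 * x $ 1 + a $ 2 * x $ 2 + a $ 3 * x $ 3"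

lemma vec3_eq_iff: "x = y \<longleftrightarrow> x $ 1 = y $ 1 \<and> x $ 2 = y $ 2 \<and> x $ 3 = y $ 3"
  for x y :: "'a ^ 3"
  by (simp add: vec_eq_iff forall_3)

lemma cov_vector [simp]: "cov (vector [a, b, c]) x = a * x $ 1 + b * x $ 2 + c * x $ 3"
  by (simp add: cov_def)

lemma cov_eval:
  "cov a (axis 1 1) = a $ 1" "cov a (axis 2 1) = a $ 2" "cov a (axis 3 1) = a $ 3"
  by (simp_all add: cov_def axis_def)

lemma inj_cov: "inj cov"
proof (rule injI)
  fix a b assume "cov a = cov b"
  then have "cov a (axis i 1) = cov b (axis i 1)" for i by simp
  from this[of 1] this[of 2] this[of 3] show "a = b" by (simp add: cov_eval vec3_eq_iff)
qed

lemma cov_in_dual: "cov a \<in> dual"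
proof -
  have "Vector_Spaces.linear (*s) (*) (cov a)"
    by unfold_locales (simp_all add: cov_def algebra_simps)
  then show ?thesis by (simp add: dual_def)
qed

lemma dual_eq_range_cov: "dual = range cov"
proof (intro equalityI subsetI)
  fix \<alpha> :: "complex ^ 3 \<Rightarrow> complex" assume "\<alpha> \<in> dual"
  then have "\<alpha> x = cov (\<chi> i. \<alpha> (axis i 1)) x" for x
    using dual_expansion[of \<alpha> x] by (simp add: cov_def sum_3 mult.commute)
  then have "\<alpha> = cov (\<chi> i. \<alpha> (axis i 1))" by blast
  then show "\<alpha> \<in> range cov" by blast
qed (auto intro: cov_in_dual)

definition s3 :: complex where "s3 = complex_of_real (sqrt 3)"

lemma s3_square [simp]: "s3 * s3 = 3" "s3 * (s3 * x) = 3 * x"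
proof -
  have "complex_of_real (sqrt 3 * sqrt 3) = 3" by simp
  then show 1: "s3 * s3 = 3" by (simp only: s3_def of_real_mult)
  then show "s3 * (s3 * x) = 3 * x" by (simp flip: mult.assoc)
qed

lemma s3_nonzero [simp]: "s3 \<noteq> 0"
  by (simp add: s3_def)

text \<open>Through the injection \<open>cov\<close>, this list of coefficient vectors turns sums
  over \<open>B7\<close> into explicit seven-term sums.\<close>

definition B7_coeffs :: "(complex ^ 3) list" where
  "B7_coeffs = [vector [1, 1, 0], vector [1, -1, 0], vector [s3, 0, s3], vector [s3, 0, - s3],
     vector [0, s3, s3], vector [0, s3, - s3], vector [0, 0, 2 * s3]]"

definition B7 :: "(complex ^ 3 \<Rightarrow> complex) set" where
  "B7 = cov ` set B7_coeffs"

lemma distinct_B7_coeffs: "distinct B7_coeffs"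
proof -
  have "s3 \<noteq> - s3" by simp
  then show ?thesis by (simp add: B7_coeffs_def vec3_eq_iff)
qed

lemma B7_subset_dual: "B7 \<subseteq> dual"
  by (auto simp: B7_def cov_in_dual)

lemma finite_B7: "finite B7"
  by (simp add: B7_def)

lemma card_B7: "card B7 = 7"
  using distinct_B7_coeffs card_image[OF inj_on_subset[OF inj_cov subset_UNIV], of "set B7_coeffs"]
  by (simp add: B7_def distinct_card) (simp add: B7_coeffs_def)

lemma sum_B7: "(\<Sum>\<alpha>\<in>B7. f \<alpha>) = (\<Sum>a\<leftarrow>B7_coeffs. f (cov a))"
  unfolding B7_def sum.reindex[OF inj_on_subset[OF inj_cov subset_UNIV]]
  by (simp add: sum.distinct_set_conv_list[OF distinct_B7_coeffs])

text \<open>Mixed terms cancel between the plus and minus covectors. The diagonal entries are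
  \<open>1 + 1 + 3 + 3\<close> twice and \<open>3 + 3 + 3 + 3 + 12\<close>.\<close>

lemma canon_form_B7: "canon_form B7 x y = 8 * x $ 1 * y $ 1 + 8 * x $ 2 * y $ 2 + 24 * x $ 3 * y $ 3"
  unfolding canon_form_def sum_B7 by (simp add: B7_coeffs_def algebra_simps)

lemma vee_B7: "vee B7 (cov a) = vector [a $ 1 / 8, a $ 2 / 8, a $ 3 / 24]"
  unfolding vee_def
proof (rule the_equality)
  fix v assume v: "\<forall>x. canon_form B7 v x = cov a x"
  have "canon_form B7 v (axis i 1) = cov a (axis i 1)" for i using v by blast
  from this[of 1] this[of 2] this[of 3] show "v = vector [a $ 1 / 8, a $ 2 / 8, a $ 3 / 24]"
    by (simp add: canon_form_B7 cov_eval vec3_eq_iff) (simp add: axis_def field_simps)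
qed (simp add: canon_form_B7 cov_def)

lemma flat_residue_B7:
  "flat_residue \<kappa> B7 p v =
    \<kappa> *s (\<Sum>a\<leftarrow>B7_coeffs. if cov a p = 0 then cov a v *s vee B7 (cov a) else 0)"
  unfolding flat_residue_def
  by (simp add: sum.inter_filter[OF finite_B7] sum_B7)

text \<open>Every covector vanishes at \<open>0\<close>, and the full sum of
  \<open>\<alpha> v *s vee B7 \<alpha>\<close> is \<open>v\<close> because \<open>vee\<close> is
  dual with respect to the canonical form.\<close>

lemma flat_residue_B7_0: "flat_residue \<kappa> B7 0 v = \<kappa> *s v"
  unfolding flat_residue_B7 by (simp add: B7_coeffs_def vee_B7 vec3_eq_iff algebra_simps)

text \<open>The three covectors vanishing here contribute \<open>(3 + 3) / 8\<close> to the second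
  coordinate and \<open>(3 + 3 + 12) / 24\<close> to the third; both equal
  \<open>3 / 4\<close>.\<close>

lemma flat_residue_B7_axis1:
  "flat_residue \<kappa> B7 (axis 1 1) v = (3 / 4 * \<kappa>) *s vector [0, v $ 2, v $ 3]"
  unfolding flat_residue_B7
  by (simp add: B7_coeffs_def vee_B7 vec3_eq_iff algebra_simps) (simp add: axis_def algebra_simps)

lemma flat_residue_B7_axis2:
  "flat_residue \<kappa> B7 (axis 2 1) v = (3 / 4 * \<kappa>) *s vector [v $ 1, 0, v $ 3]"
  unfolding flat_residue_B7
  by (simp add: B7_coeffs_def vee_B7 vec3_eq_iff algebra_simps) (simp add: axis_def algebra_simps)

section \<open>Uniqueness of solutions with exponent 1, 2 or 3\<close>

lemma regular_B7_example: "regular B7 (vector [3, 2, 1])"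
  by (simp add: regular_def B7_def B7_coeffs_def)

lemma B7_solution_eq_0:
  assumes "poly_vector_field \<psi>" "solves_system (of_nat m) B7 \<psi>" "m \<in> {1, 2, 3}"
    and p: "p \<in> {axis 1 1, axis 2 1}" "\<psi> p = 0" and "regular B7 x"
  shows "\<psi> x = 0"
proof (rule solution_eq_0[OF finite_B7 B7_subset_dual assms(1,2,6) p(2)])
  fix k :: nat and v :: "complex ^ 3"
  assume k: "k > 0" and eig: "of_nat k *s v = flat_residue (of_nat m) B7 p v"
  \<comment> \<open>Equality \<open>4 * k = 3 * m\<close> would force 4 to divide \<open>m\<close>.
    So \<open>k\<close> is neither of the residue eigenvalues \<open>0\<close> and
    \<open>3 m / 4\<close>.\<close>
  have "(of_nat (4 * k) :: complex) \<noteq> of_nat (3 * m)"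
    unfolding of_nat_eq_iff using assms(3) by auto presburger+
  then have ne: "of_nat k \<noteq> 3 / 4 * (of_nat m :: complex)"
    by (auto simp: mult.commute)
  have "of_nat k *s v = (3 / 4 * of_nat m) *s vector [0, v $ 2, v $ 3] \<or>
      of_nat k *s v = (3 / 4 * of_nat m) *s vector [v $ 1, 0, v $ 3]"
    using p(1) eig by (metis flat_residue_B7_axis1 flat_residue_B7_axis2 insertE singletonD)
  then show "v = 0" using k ne by (auto simp: vec3_eq_iff)
qed

text \<open>The residue at \<open>p\<close> annihilates \<open>\<psi> p\<close>, and for
  \<open>\<kappa> \<noteq> 0\<close> its kernel is the line through \<open>p\<close>.\<close>

lemma B7_solution_at_axis:
  assumes "poly_vector_field \<psi>" "solves_system \<kappa> B7 \<psi>" "\<kappa> \<noteq> 0" and "p \<in> {axis 1 1, axis 2 1}"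
  shows "\<exists>c. \<psi> p = c *s p"
proof -
  have res: "flat_residue \<kappa> B7 p (\<psi> p) = 0"
    by (rule solution_tangent_to_flat[OF finite_B7 B7_subset_dual assms(1,2) regular_B7_example])
  from assms(4) consider "p = axis 1 1" | "p = axis 2 1" by blast
  then show ?thesis
  proof cases
    case 1
    have "(3 / 4 * \<kappa>) *s vector [0, \<psi> p $ 2, \<psi> p $ 3] = (0 :: complex ^ 3)"
      using res unfolding 1 flat_residue_B7_axis1 .
    then have "\<psi> p = \<psi> p $ 1 *s axis 1 1"
      using assms(3) by (simp add: vec3_eq_iff) (simp add: axis_def)
    then have "\<psi> p = \<psi> p $ 1 *s p" by (simp only: 1)
    then show ?thesis ..
  next
    case 2
    have "(3 / 4 * \<kappa>) *s vector [\<psi> p $ 1, 0, \<psi> p $ 3] = (0 :: complex ^ 3)"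
      using res unfolding 2 flat_residue_B7_axis2 .
    then have "\<psi> p = \<psi> p $ 2 *s axis 2 1"
      using assms(3) by (simp add: vec3_eq_iff) (simp add: axis_def)
    then have "\<psi> p = \<psi> p $ 2 *s p" by (simp only: 2)
    then show ?thesis ..
  qed
qed

section \<open>Symmetry under sign flips and oddness\<close>

definition sign_flips :: "(complex ^ 3) set" where
  "sign_flips = {vector [1, -1, -1], vector [-1, 1, 1]}"

lemma sign_flips_involution: "d \<in> sign_flips \<Longrightarrow> diag_act d (diag_act d x) = x"
  by (auto simp: sign_flips_def vec3_eq_iff)

lemma cov_diag_act: "cov a (diag_act d x) = cov (diag_act d a) x"
  by (simp add: cov_def)

text \<open>A flip permutes the seven coefficient vectors up to sign, and evenness of
  \<open>T\<close> absorbs the signs.\<close>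

lemma sum_B7_sign_flip:
  fixes T :: "complex ^ 3 \<Rightarrow> 'a::comm_monoid_add"
  assumes d: "d \<in> sign_flips" and even: "\<And>a. T (- a) = T a"
  shows "(\<Sum>a\<leftarrow>B7_coeffs. T (diag_act d a)) = (\<Sum>a\<leftarrow>B7_coeffs. T a)"
proof -
  have neg: "- vector [a, b, c] = (vector [- a, - b, - c] :: complex ^ 3)" for a b c
    by (simp add: vec3_eq_iff)
  have T: "T (vector [- a, - b, - c]) = T (vector [a, b, c])" for a b c
    using even[of "vector [a, b, c]"] by (simp add: neg)
  have act: "diag_act (vector [a, b, c] :: complex ^ 3) (vector [a', b', c']) = vector [a * a', b * b', c * c' :: complex]"
    for a b c a' b' c' :: complex
    by (simp add: vec3_eq_iff)
  show ?thesis
    using d T[of 1 1 0] T[of 1 "-1" 0] T[of s3 0 s3] T[of s3 0 "- s3"] T[of 0 s3 s3] T[of 0 s3 "- s3"]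
      T[of 0 0 "2 * s3"]
    by (auto simp: sign_flips_def B7_coeffs_def act ac_simps)
qed

lemma regular_B7_iff:
  "regular B7 x \<longleftrightarrow> x $ 1 \<noteq> x $ 2 \<and> x $ 1 \<noteq> - x $ 2 \<and> x $ 1 \<noteq> x $ 3 \<and> x $ 1 \<noteq> - x $ 3 \<and>
    x $ 2 \<noteq> x $ 3 \<and> x $ 2 \<noteq> - x $ 3 \<and> x $ 3 \<noteq> 0"
proof -
  have "s3 * a + s3 * b = 0 \<longleftrightarrow> a = - b" for a b
    by (simp add: eq_neg_iff_add_eq_0 flip: distrib_left)
  then show ?thesis
    by (auto simp: regular_def B7_def B7_coeffs_def eq_neg_iff_add_eq_0)
qed

lemma regular_B7_sign_flip:
  assumes d: "d \<in> sign_flips" and "regular B7 x"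
  shows "regular B7 (diag_act d x)"
  using assms by (auto simp: sign_flips_def regular_B7_iff) (metis minus_minus)+

text \<open>The flip permutes \<open>B7\<close> up to sign, preserves the canonical form and is an
  involution, so conjugating by it preserves the system.\<close>

lemma solves_system_B7_sign_flip:
  assumes d: "d \<in> sign_flips" and sol: "solves_system \<kappa> B7 \<psi>"
  shows "solves_system \<kappa> B7 (\<lambda>x. diag_act d (\<psi> (diag_act d x)))"
  unfolding solves_system_def
proof (intro allI impI)
  fix \<xi> x :: "complex ^ 3" and i :: 3 assume "\<forall>\<alpha>\<in>B7. \<alpha> x \<noteq> 0"
  then have reg: "regular B7 (diag_act d x)"
    using regular_B7_sign_flip[OF d, of x] by (simp add: regular_def)
  let ?F = "\<lambda>\<xi> x v. \<kappa> *s (\<Sum>\<alpha>\<in>B7. (\<alpha> \<xi> * \<alpha> v / \<alpha> x) *s vee B7 \<alpha>)"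
  have F_nth: "?F \<xi> x v $ i
      = \<kappa> * (\<Sum>a\<leftarrow>B7_coeffs. (cov a \<xi> * cov a v / cov a x) * vee B7 (cov a) $ i)" for \<xi> x v
    unfolding vector_smult_component sum_component by (simp only: sum_B7)
  define v where "v = \<psi> (diag_act d x)"
  have dd: "d $ i * (d $ i * z) = z" for z
    using d exhaust_3[of i] by (auto simp: sign_flips_def)
  let ?T = "\<lambda>a. (cov a \<xi> * cov a (diag_act d v) / cov a x) * vee B7 (cov a) $ i"
  have "?F (diag_act d \<xi>) (diag_act d x) v $ i
      = \<kappa> * (\<Sum>a\<leftarrow>B7_coeffs. d $ i * ?T (diag_act d a))"
  proof -
    \<comment> \<open>\<open>vee\<close> commutes with the flip because the canonical form is
      diagonal.\<close>
    have vee: "vee B7 (cov a) $ i = d $ i * vee B7 (cov (diag_act d a)) $ i" for a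
      using exhaust_3[of i] dd by (auto simp: vee_B7)
    have "cov a v = cov (diag_act d a) (diag_act d v)" for a
      using sign_flips_involution[OF d] by (simp add: cov_diag_act[symmetric])
    then have "cov a (diag_act d \<xi>) * cov a v / cov a (diag_act d x) * vee B7 (cov a) $ i
        = d $ i * ?T (diag_act d a)" for a
      using vee[of a] by (simp only: cov_diag_act[of a d]) simp
    then show ?thesis by (simp only: F_nth)
  qed
  also have "(\<Sum>a\<leftarrow>B7_coeffs. d $ i * ?T (diag_act d a)) = (\<Sum>a\<leftarrow>B7_coeffs. d $ i * ?T a)"
  proof (rule sum_B7_sign_flip[OF d])
    \<comment> \<open>Replacing \<open>a\<close> by \<open>- a\<close> changes the sign of three
      covector values and of \<open>vee\<close>, four signs in all, which cancel.\<close>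
    fix a
    have "cov (- a) y = - cov a y" for y by (simp add: cov_def)
    moreover have "vee B7 (cov (- a)) $ i = - vee B7 (cov a) $ i"
      using exhaust_3[of i] by (auto simp: vee_B7)
    ultimately show "d $ i * ?T (- a) = d $ i * ?T a" by simp
  qed
  finally have F: "d $ i * ?F (diag_act d \<xi>) (diag_act d x) v $ i = ?F \<xi> x (diag_act d v) $ i"
    by (simp only: F_nth sum_list_const_mult mult.left_commute[of "d $ i" \<kappa>] dd)
  have "((\<lambda>t. \<psi> (diag_act d x + t *s diag_act d \<xi>) $ i) has_field_derivative
      ?F (diag_act d \<xi>) (diag_act d x) v $ i) (at 0)"
    using sol reg unfolding solves_system_def regular_def v_def by blast
  from DERIV_cmult[OF this, of "d $ i"]
  have "((\<lambda>t. d $ i * \<psi> (diag_act d x + t *s diag_act d \<xi>) $ i) has_field_derivative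
      ?F \<xi> x (diag_act d v) $ i) (at 0)"
    unfolding F .
  moreover have "diag_act d x + t *s diag_act d \<xi> = diag_act d (x + t *s \<xi>)" for t
    by (simp add: vec_eq_iff algebra_simps)
  ultimately show "((\<lambda>t. diag_act d (\<psi> (diag_act d (x + t *s \<xi>))) $ i) has_field_derivative
      ?F \<xi> x (diag_act d (\<psi> (diag_act d x))) $ i) (at 0)"
    by (simp add: v_def)
qed

text \<open>The difference of \<open>\<psi>\<close> and its conjugate is again a solution. It
  vanishes at a base point fixed by \<open>d\<close>, where \<open>\<psi>\<close> is a multiple of
  that point, so \<open>B7_solution_eq_0\<close> applies.\<close>

lemma B7_solution_sign_flip:
  assumes pol: "poly_vector_field \<psi>" and sol: "solves_system (of_nat m) B7 \<psi>" and m: "m \<in> {1, 2, 3}"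
    and d: "d \<in> sign_flips" and reg: "regular B7 x"
  shows "diag_act d (\<psi> (diag_act d x)) = \<psi> x"
proof -
  \<comment> \<open>The flip \<open>(1,-1,-1)\<close> fixes the first axis vector and
    \<open>(-1,1,1)\<close> the second.\<close>
  define p :: "complex ^ 3" where "p = (if d = vector [1, -1, -1] then axis 1 1 else axis 2 1)"
  define \<phi> where "\<phi> x = 1 *s \<psi> x + (- 1) *s diag_act d (\<psi> (diag_act d x))" for x
  have "m \<noteq> 0" using m by auto
  have dp: "diag_act d p = p"
    using d by (auto simp: p_def sign_flips_def vec3_eq_iff) (auto simp: axis_def)
  have "diag_act d (c *s p) = c *s p" for c
    using dp by (simp add: vec_eq_iff mult.left_commute)
  moreover have "\<exists>c. \<psi> p = c *s p"
    by (rule B7_solution_at_axis[OF pol sol]) (use \<open>m \<noteq> 0\<close> in \<open>auto simp: p_def\<close>)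
  ultimately have "\<phi> p = 0" by (auto simp: \<phi>_def dp)
  moreover have "poly_vector_field \<phi>" "solves_system (of_nat m) B7 \<phi>"
    unfolding \<phi>_def using pol sol
    by (intro poly_vector_field_lincomb poly_vector_field_conj_diag_act
        solves_system_lincomb solves_system_B7_sign_flip B7_subset_dual d; simp)+
  ultimately have "\<phi> x = 0"
    using B7_solution_eq_0[of \<phi> m p x] m reg by (auto simp: p_def)
  then show ?thesis by (simp add: \<phi>_def)
qed

text \<open>The two flips compose to minus the identity.\<close>

lemma B7_solution_odd:
  assumes "poly_vector_field \<psi>" "solves_system (of_nat m) B7 \<psi>" "m \<in> {1, 2, 3}" "regular B7 x"
  shows "\<psi> (- x) = - \<psi> x"
proof -
  let ?d = "vector [1, -1, -1] :: complex ^ 3" and ?e = "vector [-1, 1, 1] :: complex ^ 3"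
  have d: "?d \<in> sign_flips" "?e \<in> sign_flips" by (auto simp: sign_flips_def)
  have "diag_act ?e (diag_act ?d y) = - y" for y
    by (simp add: vec3_eq_iff)
  then have "\<psi> x = diag_act ?d (\<psi> (diag_act ?d x))"
      "\<psi> (diag_act ?d x) = diag_act ?e (\<psi> (- x))"
    using B7_solution_sign_flip[OF assms(1-3) d(1) assms(4)]
      B7_solution_sign_flip[OF assms(1-3) d(2) regular_B7_sign_flip[OF d(1) assms(4)]] by simp_all
  then show ?thesis by (simp add: vec3_eq_iff)
qed

section \<open>Possible exponents and failure of harmonicity\<close>

lemma B7_exponent:
  assumes "poly_vector_field \<psi>" "solves_system \<kappa> B7 \<psi>" "regular B7 x" "\<psi> x \<noteq> 0"
  shows "\<exists>m. \<kappa> = of_nat m \<and> m \<noteq> 2"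
proof -
  obtain k h where h: "\<And>t i. \<psi> (0 + t *s (x - 0)) $ i = t ^ k * poly (h i) t"
    and ne: "(\<chi> i. poly (h i) 0) \<noteq> 0"
    and res: "of_nat k *s (\<chi> i. poly (h i) 0) = flat_residue \<kappa> B7 0 (\<chi> i. poly (h i) 0)"
    using solution_leading_term[OF finite_B7 B7_subset_dual assms] by metis
  \<comment> \<open>The residue at the origin is \<open>\<kappa>\<close> times the identity, so a
    nonzero leading vector forces \<open>\<kappa>\<close> to be the order \<open>k\<close>.\<close>
  have \<kappa>: "\<kappa> = of_nat k" using ne res by (auto simp: flat_residue_B7_0)
  moreover have "k \<noteq> 2"
  proof
    assume k: "k = 2"
    \<comment> \<open>Since \<open>t\<^sup>2\<close> is even and the solution is odd,
      \<open>h i\<close> is odd away from \<open>0\<close>; letting \<open>t\<close> tend to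
      \<open>0\<close> makes the leading vector vanish. The limit with a factor \<open>c\<close>
      serves both \<open>t\<close> and \<open>- t\<close>.\<close>
    have "poly (h i) 0 = 0" for i
    proof -
      have lim: "((\<lambda>t. poly (h i) (c * t)) \<longlongrightarrow> poly (h i) 0) (at 0)" for c
        by (rule tendsto_eq_intros | simp)+
      have "\<forall>\<^sub>F t in at 0. poly (h i) (1 * t) = - poly (h i) (- 1 * t)"
        using eventually_neq_at_within[of 0 0 UNIV]
      proof eventually_elim
        case (elim t)
        have "regular B7 (t *s x)"
          using assms(3) elim B7_subset_dual by (auto simp: regular_def dual_scale subset_iff)
        then have "\<psi> (- (t *s x)) = - \<psi> (t *s x)"
          using B7_solution_odd[of \<psi> 2] assms(1,2) \<kappa> k by simp
        moreover have "- (t *s x) = (- t) *s x" by (simp add: vec_eq_iff)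
        ultimately have "\<psi> ((- t) *s x) $ i = - \<psi> (t *s x) $ i"
          by (simp only: vector_uminus_component)
        then have "- (t\<^sup>2 * poly (h i) t) = t\<^sup>2 * poly (h i) (- t)"
          using h[of t i] h[of "- t" i] by (simp add: k)
        then have "t\<^sup>2 * (poly (h i) t + poly (h i) (- t)) = 0"
          by (simp only: distrib_left) (simp add: neg_eq_iff_add_eq_0)
        then show ?case using elim by (simp add: eq_neg_iff_add_eq_0)
      qed
      then have "((\<lambda>t. poly (h i) (1 * t)) \<longlongrightarrow> - poly (h i) 0) (at 0)"
        using tendsto_minus[OF lim[of "- 1"]] by (rule tendsto_cong[THEN iffD2])
      from tendsto_unique[OF _ lim this] have "poly (h i) 0 = - poly (h i) 0" by simp
      then show ?thesis by simp
    qed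
    then show False using ne by (auto simp: vec_eq_iff)
  qed
  ultimately show ?thesis by blast
qed

text \<open>Both fields are multiples of the first axis vector at that vector, with factors
  \<open>a\<close> and \<open>b\<close>; here \<open>a \<noteq> 0\<close>, since otherwise
  \<open>\<psi>\<close> would vanish at \<open>x\<close>. Then
  \<open>\<phi> - (b / a) \<psi>\<close> vanishes at the axis vector, hence at
  \<open>x\<close>.\<close>

lemma B7_solutions_proportional:
  assumes \<psi>: "poly_vector_field \<psi>" "solves_system (of_nat m) B7 \<psi>"
    and \<phi>: "poly_vector_field \<phi>" "solves_system (of_nat m) B7 \<phi>"
    and m: "m \<in> {1, 2, 3}" and reg: "regular B7 x" and ne: "\<psi> x \<noteq> 0"
  shows "\<exists>c. \<phi> x = c *s \<psi> x"
proof -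
  let ?p = "axis 1 1 :: complex ^ 3"
  have "of_nat m \<noteq> (0::complex)" using m by auto
  then obtain a b where a: "\<psi> ?p = a *s ?p" and b: "\<phi> ?p = b *s ?p"
    using B7_solution_at_axis[OF \<psi>, of ?p] B7_solution_at_axis[OF \<phi>, of ?p] by blast
  have "a \<noteq> 0"
    using B7_solution_eq_0[OF \<psi> m, of ?p x] a ne reg by auto
  define \<theta> where "\<theta> x = 1 *s \<phi> x + (- (b / a)) *s \<psi> x" for x
  have "poly_vector_field \<theta>" "solves_system (of_nat m) B7 \<theta>"
    unfolding \<theta>_def using \<psi> \<phi>
    by (simp_all only: poly_vector_field_lincomb solves_system_lincomb B7_subset_dual)
  moreover have "\<theta> ?p = 0"
    using \<open>a \<noteq> 0\<close> unfolding \<theta>_def a b by (simp add: vec_eq_iff)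
  ultimately have "\<theta> x = 0"
    using B7_solution_eq_0[of \<theta> m ?p x] m reg by auto
  then have "\<phi> x = (b / a) *s \<psi> x" by (simp add: \<theta>_def)
  then show ?thesis ..
qed

lemma B7_not_harmonic: "\<not> harmonic B7"
proof
  assume "harmonic B7"
  then obtain \<kappa> :: "3 \<Rightarrow> complex" and \<psi> where \<kappa>: "\<And>i. \<kappa> i \<noteq> 0"
    and pol: "\<And>i. poly_vector_field (\<psi> i)" and sol: "\<And>i. solves_system (\<kappa> i) B7 (\<psi> i)"
    and gen: "generically (\<lambda>x. inj (\<lambda>i. \<psi> i x) \<and> vec.independent (range (\<lambda>i. \<psi> i x)))"
    and sum: "(\<Sum>i\<in>UNIV. \<kappa> i) = of_nat (card B7)"
    unfolding harmonic_def by blast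
  \<comment> \<open>One point that is both generic and regular suffices, since proportionality of
    two solutions there already contradicts independence.\<close>
  obtain x where inj: "inj (\<lambda>i. \<psi> i x)" and ind: "vec.independent (range (\<lambda>i. \<psi> i x))"
    and reg: "regular B7 x"
    using generic_regular_point[OF gen finite_B7 B7_subset_dual regular_B7_example] by blast
  have ne: "\<psi> i x \<noteq> 0" for i
    using ind vec.dependent_zero by (metis rangeI)
  obtain m where m: "\<And>i. \<kappa> i = of_nat (m i)" "\<And>i. m i \<noteq> 2"
    using B7_exponent[OF pol sol reg ne] by metis
  have "of_nat (m 1 + m 2 + m 3) = (of_nat 7 :: complex)"
    using sum by (simp add: card_B7 m(1) sum_3)
  then have sum7: "m 1 + m 2 + m 3 = 7" by (simp only: of_nat_eq_iff)
  have pos: "m i > 0" for i using \<kappa>[of i] m(1)[of i] by (cases "m i") auto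
  have distinct: "m i \<noteq> m j" if mi: "m i \<in> {1, 2, 3}" and ij: "i \<noteq> j" for i j
  proof
    assume eq: "m i = m j"
    obtain c where "\<psi> j x = c *s \<psi> i x"
      using B7_solutions_proportional[OF pol[of i] _ pol[of j] _ mi reg ne] sol[of i] sol[of j] eq m(1)
      by auto
    moreover have "\<psi> i x \<in> range (\<lambda>i. \<psi> i x) - {\<psi> j x}"
      using ij inj by (auto dest: injD)
    ultimately have "\<psi> j x \<in> vec.span (range (\<lambda>i. \<psi> i x) - {\<psi> j x})"
      using vec.span_scale vec.span_base by metis
    then show False using ind unfolding vec.dependent_def by blast
  qed
  show False
    using sum7 pos[of 1] pos[of 2] pos[of 3] m(2)[of 1] m(2)[of 2] m(2)[of 3]
      distinct[of 1 2] distinct[of 1 3] distinct[of 2 3] distinct[of 2 1]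
    by simp presburger
qed

section \<open>The \<open>\<or>\<close>-condition\<close>

lemma cov_zero: "cov 0 = 0"
  by (simp add: fun_eq_iff cov_def)

lemma covec_add: "cov a + cov b = cov (a + b)"
  and covec_scale: "cscale c (cov a) = cov (c *s a)"
  by (simp_all add: fun_eq_iff cov_def cscale_def algebra_simps)

definition crossp :: "complex ^ 3 \<Rightarrow> complex ^ 3 \<Rightarrow> complex ^ 3" where
  "crossp a b = vector [a $ 2 * b $ 3 - a $ 3 * b $ 2, a $ 3 * b $ 1 - a $ 1 * b $ 3,
     a $ 1 * b $ 2 - a $ 2 * b $ 1]"

lemma cov_crossp: "cov a (crossp a b) = 0" "cov b (crossp a b) = 0"
  by (simp_all add: cov_def crossp_def algebra_simps)

text \<open>Cramer's rule without division: the hypothesis is that the determinant of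
  \<open>a\<close>, \<open>b\<close>, \<open>c\<close> vanishes.\<close>

lemma crossp_expansion:
  assumes "cov c (crossp a b) = 0"
  shows "crossp a b $ k *s c = crossp c b $ k *s a + crossp a c $ k *s b"
proof -
  have "c $ 1 * (a $ 2 * b $ 3 - a $ 3 * b $ 2) + c $ 2 * (a $ 3 * b $ 1 - a $ 1 * b $ 3) +
      c $ 3 * (a $ 1 * b $ 2 - a $ 2 * b $ 1) = 0"
    using assms by (simp add: cov_def crossp_def)
  then have "\<forall>k. crossp a b $ k *s c = crossp c b $ k *s a + crossp a c $ k *s b"
    unfolding forall_3 by (simp add: crossp_def vec3_eq_iff) algebra
  then show ?thesis ..
qed

text \<open>A zero cross product means proportional coefficients: a nonzero coordinate of
  \<open>b\<close> gives the factor. The assumption \<open>a \<noteq> b\<close> keeps the pair from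
  collapsing to a singleton.\<close>

lemma independent_cov_pair_iff:
  assumes "a \<noteq> b"
  shows "covec.independent {cov a, cov b} \<longleftrightarrow> crossp a b \<noteq> 0"
proof -
  have dep: "cov a \<in> covec.span {cov b} \<longleftrightarrow> (\<exists>k. a = k *s b)"
    by (auto simp: covec.span_singleton covec_scale inj_eq[OF inj_cov])
  have "(\<exists>k. a = k *s b) \<or> b = 0 \<longleftrightarrow> crossp a b = 0"
  proof
    assume cross: "crossp a b = 0"
    show "(\<exists>k. a = k *s b) \<or> b = 0"
    proof (rule disjCI)
      assume "b \<noteq> 0"
      then obtain i where i: "b $ i \<noteq> 0" by (auto simp: vec_eq_iff)
      have "a $ j * b $ i = a $ i * b $ j" for j
        using cross exhaust_3[of i] exhaust_3[of j] by (auto simp: crossp_def vec3_eq_iff mult.commute)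
      then have "a = (a $ i / b $ i) *s b" using i by (simp add: vec_eq_iff field_simps)
      then show "\<exists>k. a = k *s b" ..
    qed
  qed (auto simp: crossp_def vec3_eq_iff)
  moreover have "cov a \<noteq> cov b" using assms by (simp add: inj_eq[OF inj_cov])
  moreover have "cov b = 0 \<longleftrightarrow> b = 0" using inj_eq[OF inj_cov, of b 0] by (simp add: cov_zero)
  ultimately show ?thesis by (simp add: covec.independent_insert dep) blast
qed

text \<open>The point is the cross product of the coefficient vectors of a basis of
  \<open>P\<close>. This lets the sum in the \<or>-condition be read as a residue at
  \<open>p\<close>.\<close>

lemma plane_eq_annihilator:
  fixes P :: "(complex ^ 3 \<Rightarrow> complex) set"
  assumes P: "covec.subspace P" "P \<subseteq> dual" and dim: "covec.dim P = 2"
  obtains p where "p \<noteq> 0" "P = {\<alpha> \<in> dual. \<alpha> p = 0}"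
proof -
  obtain B where B: "B \<subseteq> P" "covec.independent B" "P \<subseteq> covec.span B" "card B = 2"
    using covec.basis_exists[of P] dim by metis
  then obtain f g where fg: "B = {f, g}" "f \<noteq> g" by (auto simp: card_2_iff)
  then have "f \<in> range cov" "g \<in> range cov"
    using B(1) P(2) by (auto simp: dual_eq_range_cov)
  then obtain a b where ab: "f = cov a" "g = cov b" by blast
  define p where "p = crossp a b"
  have "p \<noteq> 0"
    using B(2) fg independent_cov_pair_iff[of a b] by (auto simp: ab p_def)
  moreover have "P = {\<alpha> \<in> dual. \<alpha> p = 0}"
  proof (intro equalityI subsetI)
    fix \<alpha> assume "\<alpha> \<in> P"
    then obtain u v where "\<alpha> - cscale u (cov a) = cscale v (cov b)"
      using B(3) by (auto simp: fg ab covec.span_insert covec.span_singleton)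
    then have "\<alpha> x - u * cov a x = v * cov b x" for x
      by (auto simp: cscale_def dest!: fun_cong[of _ _ x])
    from this[of p] have "\<alpha> p = 0" by (simp add: p_def cov_crossp)
    then show "\<alpha> \<in> {\<alpha> \<in> dual. \<alpha> p = 0}" using \<open>\<alpha> \<in> P\<close> P(2) by blast
  next
    fix \<alpha> assume "\<alpha> \<in> {\<alpha> \<in> dual. \<alpha> p = 0}"
    then obtain c where c: "\<alpha> = cov c" "cov c p = 0" by (auto simp: dual_eq_range_cov)
    \<comment> \<open>Dividing by a nonzero coordinate of \<open>p\<close> turns
      \<open>crossp_expansion\<close> into a combination of the basis.\<close>
    obtain k where k: "p $ k \<noteq> 0" using \<open>p \<noteq> 0\<close> by (auto simp: vec_eq_iff)
    have "p $ k *s c = crossp c b $ k *s a + crossp a c $ k *s b"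
      using crossp_expansion c(2) unfolding p_def .
    then have "cscale (p $ k) \<alpha> = cscale (crossp c b $ k) f + cscale (crossp a c $ k) g"
      by (simp add: c ab covec_add covec_scale)
    also have "\<dots> \<in> P"
      using P(1) B(1) by (auto simp: fg intro!: covec.subspace_add covec.subspace_scale)
    finally have "cscale (inverse (p $ k)) (cscale (p $ k) \<alpha>) \<in> P"
      using P(1) by (rule covec.subspace_scale[rotated])
    then show "\<alpha> \<in> P" using k by simp
  qed
  ultimately show ?thesis using that by blast
qed

text \<open>This is the \<or>-condition for the plane annihilated by \<open>p\<close>. If the plane
  contains no further covector of \<open>B7\<close>, or just one orthogonal to \<open>cov a\<close>,
  then \<open>\<nu>\<close> is the value of \<open>cov a\<close> on its own dual vector. The
  remaining planes contain three covectors.\<close>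

lemma flat_residue_B7_eigenvector:
  assumes a: "a \<in> set B7_coeffs" and p: "p \<noteq> 0" "cov a p = 0"
  shows "\<exists>\<nu>. flat_residue 1 B7 p (vee B7 (cov a)) = \<nu> *s vee B7 (cov a)"
proof -
  define x y z where "x = p $ 1" and "y = p $ 2" and "z = p $ 3"
  have nz: "x \<noteq> 0 \<or> y \<noteq> 0 \<or> z \<noteq> 0"
    using p(1) by (simp add: x_def y_def z_def vec3_eq_iff)
  have s3_eq: "s3 * u + s3 * v = 0 \<longleftrightarrow> v = - u" "s3 * u - s3 * v = 0 \<longleftrightarrow> v = u" for u v
    by (simp add: eq_neg_iff_add_eq_0 add.commute[of v] flip: distrib_left) auto
  \<comment> \<open>Vanishing at \<open>p\<close> is stated as equations solved for one coordinate,
    so that each case can decide which of the seven terms survive.\<close>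
  have conds:
    "cov (vector [1, 1, 0]) p = 0 \<longleftrightarrow> y = - x" "cov (vector [1, -1, 0]) p = 0 \<longleftrightarrow> y = x"
    "cov (vector [s3, 0, s3]) p = 0 \<longleftrightarrow> z = - x" "cov (vector [s3, 0, - s3]) p = 0 \<longleftrightarrow> z = x"
    "cov (vector [0, s3, s3]) p = 0 \<longleftrightarrow> z = - y" "cov (vector [0, s3, - s3]) p = 0 \<longleftrightarrow> z = y"
    "cov (vector [0, 0, 2 * s3]) p = 0 \<longleftrightarrow> z = 0"
    by (simp_all add: s3_eq add_eq_0_iff[of x y] eq_commute[of x] eq_commute[of y z] flip: x_def y_def z_def)
  have signs: "u = - u \<longleftrightarrow> u = 0" "- u = u \<longleftrightarrow> u = 0"
    "x = - y \<longleftrightarrow> y = - x" "- x = y \<longleftrightarrow> y = - x" "- y = x \<longleftrightarrow> y = - x" for u :: complex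
    by auto
  note [simp] = flat_residue_B7[of 1 p, unfolded B7_coeffs_def list.map conds] vee_B7 vec3_eq_iff signs
  consider "a = vector [1, 1, 0]" | "a = vector [1, -1, 0]"
    | "a = vector [s3, 0, s3]" | "a = vector [s3, 0, - s3]"
    | "a = vector [0, s3, s3]" | "a = vector [0, s3, - s3]" | "a = vector [0, 0, 2 * s3]"
    using a unfolding B7_coeffs_def by (simp only: set_simps insert_iff empty_iff) blast
  then show ?thesis
  proof cases
    case 1
    have "y = - x" using p(2) unfolding 1 conds .
    with nz show ?thesis unfolding 1
      \<comment> \<open>The value \<open>1 / 4\<close> is that of the covector on its own dual
        vector; \<open>5 / 8\<close> belongs to the triples on planes such as
        \<open>x = - y = z\<close>.\<close>
      by (intro exI[of _ "if x = 0 \<or> (z \<noteq> x \<and> z \<noteq> - x) then 1 / 4 else 5 / 8"])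
         (cases "x = 0"; cases "z = x"; cases "z = - x"; simp)
  next
    case 2
    have "y = x" using p(2) unfolding 2 conds .
    with nz show ?thesis unfolding 2
      by (intro exI[of _ "if x = 0 \<or> (z \<noteq> x \<and> z \<noteq> - x) then 1 / 4 else 5 / 8"])
         (cases "x = 0"; cases "z = x"; cases "z = - x"; simp)
  next
    case 3
    have "z = - x" using p(2) unfolding 3 conds .
    with nz show ?thesis unfolding 3
      \<comment> \<open>Here \<open>1 / 2\<close> is the covector on its own dual vector,
        \<open>3 / 4\<close> is the eigenvalue at the second axis, and \<open>5 / 8\<close> again
        comes from a triple.\<close>
      by (intro exI[of _ "if x = 0 then 3 / 4 else if x = y \<or> x = - y then 5 / 8 else 1 / 2"])
         (cases "x = 0"; cases "x = y"; cases "x = - y"; simp)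
  next
    case 4
    have "z = x" using p(2) unfolding 4 conds .
    with nz show ?thesis unfolding 4
      by (intro exI[of _ "if x = 0 then 3 / 4 else if x = y \<or> x = - y then 5 / 8 else 1 / 2"])
         (cases "x = 0"; cases "x = y"; cases "x = - y"; simp)
  next
    case 5
    have "z = - y" using p(2) unfolding 5 conds .
    with nz show ?thesis unfolding 5
      by (intro exI[of _ "if y = 0 then 3 / 4 else if x = y \<or> x = - y then 5 / 8 else 1 / 2"])
         (cases "y = 0"; cases "x = y"; cases "x = - y"; simp)
  next
    case 6
    have "z = y" using p(2) unfolding 6 conds .
    with nz show ?thesis unfolding 6
      by (intro exI[of _ "if y = 0 then 3 / 4 else if x = y \<or> x = - y then 5 / 8 else 1 / 2"])
         (cases "y = 0"; cases "x = y"; cases "x = - y"; simp)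
  next
    case 7
    have "z = 0" using p(2) unfolding 7 conds .
    with nz show ?thesis unfolding 7
      \<comment> \<open>On the planes with \<open>x = y\<close> or \<open>x = - y\<close> the other
        covector is orthogonal to this one, so \<open>1 / 2\<close> persists; at the axes the
        eigenvalue is \<open>3 / 4\<close>.\<close>
      by (intro exI[of _ "if x = 0 \<or> y = 0 then 3 / 4 else 1 / 2"])
         (cases "x = 0"; cases "y = 0"; cases "x = y"; cases "x = - y"; simp)
  qed
qed

lemma span_B7: "covec.span B7 = dual"
proof
  have "covec.subspace (dual :: (complex ^ 3 \<Rightarrow> complex) set)"
  proof (rule covec.subspaceI)
    show "0 \<in> (dual :: (complex ^ 3 \<Rightarrow> complex) set)" using cov_in_dual[of 0] by (simp add: cov_zero)
  qed (auto simp: dual_eq_range_cov covec_add covec_scale)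
  then show "covec.span B7 \<subseteq> dual" by (rule covec.span_minimal[OF B7_subset_dual])
  show "dual \<subseteq> covec.span B7"
  proof
    fix \<alpha> :: "complex ^ 3 \<Rightarrow> complex" assume "\<alpha> \<in> dual"
    then obtain a where a: "\<alpha> = cov a" by (auto simp: dual_eq_range_cov)
    let ?b = "vector [1, 1, 0]" and ?c = "vector [1, -1, 0]" and ?d = "vector [0, 0, 2 * s3]"
    have "\<alpha> = cscale ((a $ 1 + a $ 2) / 2) (cov ?b) + (cscale ((a $ 1 - a $ 2) / 2) (cov ?c)
        + cscale (a $ 3 / (2 * s3)) (cov ?d))"
      unfolding a covec_add covec_scale inj_eq[OF inj_cov]
      by (simp add: vec3_eq_iff field_simps)
    also have "\<dots> \<in> covec.span B7"
      by (intro covec.span_add covec.span_scale covec.span_base) (simp_all add: B7_def B7_coeffs_def)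
    finally show "\<alpha> \<in> covec.span B7" .
  qed
qed

lemma vee_system_B7: "vee_system B7"
  unfolding vee_system_def
proof (intro conjI ballI allI impI)
  fix \<alpha> \<beta> assume "\<alpha> \<in> B7" "\<beta> \<in> B7" "\<alpha> \<noteq> \<beta>"
  then obtain a b where "a \<in> set B7_coeffs" "b \<in> set B7_coeffs" "a \<noteq> b"
    and \<alpha>\<beta>: "\<alpha> = cov a" "\<beta> = cov b"
    by (auto simp: B7_def)
  moreover from this(1-3) have "crossp a b \<noteq> 0"
    by (auto simp: B7_coeffs_def crossp_def vec3_eq_iff)
  ultimately show "covec.independent {\<alpha>, \<beta>}"
    by (simp add: independent_cov_pair_iff)
next
  show "nondegenerate (canon_form B7)"
    unfolding nondegenerate_def
  proof (intro allI impI)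
    fix x assume x: "\<forall>y. canon_form B7 x y = 0"
    have "canon_form B7 x (axis i 1) = 0" for i using x by blast
    from this[of 1] this[of 2] this[of 3] show "x = 0"
      by (simp add: canon_form_B7 vec3_eq_iff) (simp add: axis_def)
  qed
next
  fix \<alpha> and P :: "(complex ^ 3 \<Rightarrow> complex) set"
  assume "\<alpha> \<in> B7" and P: "covec.subspace P \<and> P \<subseteq> dual \<and> covec.dim P = 2 \<and> \<alpha> \<in> P"
  then obtain a where a: "a \<in> set B7_coeffs" "\<alpha> = cov a" by (auto simp: B7_def)
  obtain p where p: "p \<noteq> 0" "P = {\<alpha> \<in> dual. \<alpha> p = 0}"
    using P plane_eq_annihilator[of P] by blast
  \<comment> \<open>Membership in the plane is vanishing at \<open>p\<close>, so the sum is the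
    residue with \<open>\<kappa> = 1\<close>.\<close>
  have "P \<inter> B7 = {\<beta> \<in> B7. \<beta> p = 0}" using p(2) B7_subset_dual by blast
  then have "(\<Sum>\<beta>\<in>P \<inter> B7. \<beta> (vee B7 \<alpha>) *s vee B7 \<beta>) = flat_residue 1 B7 p (vee B7 \<alpha>)"
    by (simp add: flat_residue_def)
  moreover have "cov a p = 0" using P p(2) a(2) by blast
  ultimately show "\<exists>\<nu>. (\<Sum>\<beta>\<in>P \<inter> B7. \<beta> (vee B7 \<alpha>) *s vee B7 \<beta>) = \<nu> *s vee B7 \<alpha>"
    using flat_residue_B7_eigenvector[OF a(1) p(1)] a(2) by simp
qed (simp_all add: finite_B7 B7_subset_dual span_B7)

section \<open>Identification with the family \<open>B_system\<close>\<close>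

lemma B7_eq:
  "B7 = {(\<lambda>x. x $ 1 + x $ 2), (\<lambda>x. x $ 1 - x $ 2),
     (\<lambda>x. s3 * (x $ 1 + x $ 3)), (\<lambda>x. s3 * (x $ 1 - x $ 3)),
     (\<lambda>x. s3 * (x $ 2 + x $ 3)), (\<lambda>x. s3 * (x $ 2 - x $ 3)), (\<lambda>x. 2 * s3 * x $ 3)}"
  by (simp add: B7_def B7_coeffs_def cov_def[abs_def] ring_distribs)

lemma B7_eq_B_system: "B7 = B_system coord 3 (-1) ((\<lambda>_. 1)(3 := 3))"
proof -
  have pairs: "{f i j | i j. 1 \<le> i \<and> i < j \<and> j \<le> 3} = {f 1 2, f 1 3, f 2 3}"
    for f :: "nat \<Rightarrow> nat \<Rightarrow> 'b"
  proof -
    have "1 \<le> i \<and> i < j \<and> j \<le> 3 \<longleftrightarrow> i = 1 \<and> j = 2 \<or> i = 1 \<and> j = 3 \<or> i = 2 \<and> j = 3" for i j :: nat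
      by auto
    then show ?thesis by auto
  qed
  have singles: "{f i | i. 1 \<le> i \<and> i \<le> 3} = {f 1, f 2, f 3}" for f :: "nat \<Rightarrow> 'b"
  proof -
    have "1 \<le> i \<and> i \<le> 3 \<longleftrightarrow> i = 1 \<or> i = 2 \<or> i = 3" for i :: nat
      by auto
    then show ?thesis by auto
  qed
  have sqrt3: "csqrt 3 = s3"
    using of_real_sqrt[of 3] by (simp add: s3_def)
  have sqrt12: "csqrt 12 = 2 * s3"
  proof -
    have "sqrt 12 = 2 * sqrt 3" using real_sqrt_mult[of 4 3] by simp
    then show ?thesis using of_real_sqrt[of 12] by (simp add: s3_def)
  qed
  have coord_cov: "coord (Suc 0) = cov (vector [1, 0, 0])" "coord 2 = cov (vector [0, 1, 0])"
    "coord 3 = cov (vector [0, 0, 1])"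
    by (simp_all add: fun_eq_iff coord_def)
  have diff: "cov a - cov b = cov (a - b)" for a b
    by (simp add: fun_eq_iff cov_def algebra_simps)
  have vecs: "vector [a, b, c] + vector [a', b', c'] = (vector [a + a', b + b', c + c'] :: complex ^ 3)"
    "vector [a, b, c] - vector [a', b', c'] = (vector [a - a', b - b', c - c'] :: complex ^ 3)"
    "vector [0, 0, 0] = (0 :: complex ^ 3)"
    "k *s vector [a, b, c] = (vector [k * a, k * b, k * c] :: complex ^ 3)" for a b c a' b' c' k
    by (simp_all add: vec3_eq_iff)
  \<comment> \<open>For \<open>i = 1, 2\<close> the factor \<open>c i + c0\<close> is zero, which
    produces the zero covector; for \<open>i = 3\<close> the scale is
    \<open>csqrt 12 = 2 * s3\<close>.\<close>
  have "B_system coord 3 (-1) ((\<lambda>_. 1)(3 := 3)) = insert 0 B7 - {0}"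
    unfolding B_system_def pairs singles
    by (simp add: coord_cov diff covec_add covec_scale vecs sqrt3 sqrt12 B7_def B7_coeffs_def
        cov_zero insert_commute)
  moreover have "0 \<notin> B7"
    unfolding B7_def cov_zero[symmetric] by (auto simp: inj_eq[OF inj_cov] B7_coeffs_def vec3_eq_iff)
  ultimately show ?thesis by simp
qed

theorem theorem8:
  fixes A :: "(complex ^ 3 \<Rightarrow> complex) set" and s :: complex
  assumes s_def: "s = complex_of_real (sqrt 3)"
    and A_def: "A = {(\<lambda>x. x $ 1 + x $ 2), (\<lambda>x. x $ 1 - x $ 2),
                     (\<lambda>x. s * (x $ 1 + x $ 3)), (\<lambda>x. s * (x $ 1 - x $ 3)),
                     (\<lambda>x. s * (x $ 2 + x $ 3)), (\<lambda>x. s * (x $ 2 - x $ 3)),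
                     (\<lambda>x. 2 * s * x $ 3)}"
  shows "A = B_system coord 3 (-1) ((\<lambda>_. 1)(3 := 3)) \<and> vee_system A \<and> \<not> harmonic A"
proof -
  have "A = B7" unfolding A_def B7_eq s_def s3_def ..
  then show ?thesis using B7_eq_B_system vee_system_B7 B7_not_harmonic by simp
qed

end
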